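(* Let $N\ge 3$ be an integer, $1\le p<N$, $p^{\ast}=\frac{Np}{N-p}$ and $q>p^{\ast}$. Let $$S:=\inf\left\{\|u\|_{D^{1,p}}^{p} : u\in D^{1,p}(\mathbb{Z}^N),\ \|u\|_{q}=1\right\},$$ and let $\{u_n\}\subset D^{1,p}(\mathbb{Z}^N)$ be a minimizing sequence, i.e. $\|u_n\|_q=1$ for all $n$ and $\|u_n\|_{D^{1,p}}^p\to S$ as $n\to\infty$. Then there exists a sequence $\{i_n\}\subset\mathbb{Z}^N$ such that the sequence of translates $v_n(i):=u_n(i+i_n)$ contains a subsequence that converges in $D^{1,p}(\mathbb{Z}^N)$ to some $v\in D^{1,p}(\mathbb{Z}^N)$, and $v$ is a minimizer for $S$, i.e. $\|v\|_q=1$ and $\|v\|_{D^{1,p}}^p=S$.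
   Context: $\mathbb{Z}^N$ is the integer lattice graph: vertices are the points of $\mathbb{Z}^N$, and $x\sim y$ iff $\sum_{k=1}^N|x_k-y_k|=1$. All functions are real-valued. $\|u\|_q=\left(\sum_{x\in\mathbb{Z}^N}|u(x)|^q\right)^{1/q}$ is the $\ell^q(\mathbb{Z}^N)$ norm. The $D^{1,p}$ norm is $$\|u\|_{D^{1,p}}=\left(\sum_{x\in\mathbb{Z}^N}\sum_{y\sim x}|u(y)-u(x)|^p\right)^{1/p},$$ and $D^{1,p}(\mathbb{Z}^N)$ is the completion of the space $C_0(\mathbb{Z}^N)$ of finitely supported functions in this norm. It is regarded as a space of functions on $\mathbb{Z}^N$: those $u$ for which there are $\varphi_k\in C_0(\mathbb{Z}^N)$ with $\varphi_k\to u$ pointwise and $\|\varphi_k-u\|_{D^{1,p}}\to 0$. By the (known) discrete Sobolev inequality, for $1\le p<N$ and $q\ge p^{\ast}$ there is a constant $C_{p,q}$ with $\|u\|_q\le C_{p,q}\|u\|_{D^{1,p}}$ for all $u\in D^{1,p}(\mathbb{Z}^N)$, so $S>0$. *)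

theory Defs
  imports "HOL-Analysis.Analysis"
begin

definition lattice_adj :: "int ^ 'n::finite \<Rightarrow> int ^ 'n \<Rightarrow> bool" where
  "lattice_adj x y \<longleftrightarrow> (\<Sum>k\<in>UNIV. \<bar>x $ k - y $ k\<bar>) = 1"

lemma finite_lattice_nbhd: "finite {y. lattice_adj x y}" for x :: "int ^ 'n::finite"
proof (rule finite_subset)
  let ?B = "PiE UNIV (\<lambda>k. {x $ k - 1 .. x $ k + 1})"
  show "finite (vec_lambda ` ?B)" by (intro finite_imageI finite_PiE) auto
  show "{y. lattice_adj x y} \<subseteq> vec_lambda ` ?B"
  proof
    fix y assume "y \<in> {y. lattice_adj x y}"
    then have "\<bar>x $ k - y $ k\<bar> \<le> 1" for k
      using member_le_sum[of k UNIV "\<lambda>k. \<bar>x $ k - y $ k\<bar>"]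
      by (simp add: lattice_adj_def)
    then have "x $ k - 1 \<le> y $ k \<and> y $ k \<le> x $ k + 1" for k
      using abs_le_D1[of "x $ k - y $ k" 1] abs_le_D2[of "x $ k - y $ k" 1] by auto
    then have "vec_nth y \<in> ?B" by (simp add: PiE_iff)
    then show "y \<in> vec_lambda ` ?B" by (metis image_eqI vec_nth_inverse)
  qed
qed

text \<open>If \<open>\<bar>u\<bar> powr q\<close> is not summable, \<^term>\<open>infsum\<close> gives the value \<open>0\<close>;
  in particular \<open>lq_norm q u = 1\<close> implies that \<open>u\<close> is a genuine element of $\ell^q$.\<close>

definition lq_norm :: "real \<Rightarrow> (int ^ 'n::finite \<Rightarrow> real) \<Rightarrow> real" where
  "lq_norm q u = (\<Sum>\<^sub>\<infinity>x. \<bar>u x\<bar> powr q) powr (1 / q)"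

definition finite_energy :: "real \<Rightarrow> (int ^ 'n::finite \<Rightarrow> real) \<Rightarrow> bool" where
  "finite_energy p u \<longleftrightarrow>
     (\<lambda>x. \<Sum>y | lattice_adj x y. \<bar>u y - u x\<bar> powr p) summable_on UNIV"

text \<open>Only meaningful under \<^term>\<open>finite_energy\<close>, which holds on the whole of \<open>D1p\<close> below.\<close>

definition D1p_norm :: "real \<Rightarrow> (int ^ 'n::finite \<Rightarrow> real) \<Rightarrow> real" where
  "D1p_norm p u =
     (\<Sum>\<^sub>\<infinity>x. \<Sum>y | lattice_adj x y. \<bar>u y - u x\<bar> powr p) powr (1 / p)"

text \<open>The energy condition excludes differences of infinite norm, to which
  \<^term>\<open>D1p_norm\<close> would assign the value \<open>0\<close>.\<close>

definition D1p_converges ::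
  "real \<Rightarrow> (nat \<Rightarrow> int ^ 'n::finite \<Rightarrow> real) \<Rightarrow> (int ^ 'n \<Rightarrow> real) \<Rightarrow> bool" where
  "D1p_converges p f u \<longleftrightarrow>
     (\<forall>k. finite_energy p (\<lambda>x. f k x - u x)) \<and>
     (\<lambda>k. D1p_norm p (\<lambda>x. f k x - u x)) \<longlonglongrightarrow> 0"

definition D1p :: "real \<Rightarrow> (int ^ 'n::finite \<Rightarrow> real) set" where
  "D1p p = {u. \<exists>\<phi>. (\<forall>k. finite {x. \<phi> k x \<noteq> 0}) \<and>
                   (\<forall>x. (\<lambda>k. \<phi> k x) \<longlonglongrightarrow> u x) \<and>
                   D1p_converges p \<phi> u}"

definition sobolev_const :: "'n::finite itself \<Rightarrow> real \<Rightarrow> real \<Rightarrow> real" where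
  "sobolev_const _ p q =
     Inf {D1p_norm p u powr p | u :: int ^ 'n \<Rightarrow> real. u \<in> D1p p \<and> lq_norm q u = 1}"

end

theory Submission
  imports Defs "HOL-Complex_Analysis.Great_Picard"
begin

text \<open>
  Write \<open>E u\<close> for the \<open>p\<close>-th power of the \<open>D1p\<close> norm and \<open>S\<close> for the infimum. Up to
  translations, a minimizing sequence can lose compactness only by spreading out and vanishing, or by
  splitting into pieces that move apart. A supercritical exponent excludes the first, strict concavity
  of \<open>t powr (p/q)\<close> the second.

  \<^emph>\<open>Vanishing.\<close> Take \<open>r\<close> strictly between the critical exponent and \<open>q\<close>. The Sobolev
  inequality for \<open>r\<close> (\<open>D1p_Sobolev\<close>) bounds the \<open>r\<close>-norms of the \<open>u n\<close>, and the sum of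
  \<open>\<bar>u\<bar> powr q\<close> is at most \<open>(sup \<bar>u\<bar>) powr (q - r)\<close> times the sum of \<open>\<bar>u\<bar> powr r\<close>. Hence
  \<open>\<bar>u n\<bar>\<close> exceeds a fixed \<open>c > 0\<close> somewhere (\<open>uniformly_nonvanishing\<close>), and translating that point
  to the origin and passing to a subsequence gives a nonzero pointwise limit \<open>v\<close>.

  \<^emph>\<open>Splitting.\<close> By \<open>Brezis_Lieb\<close>, applied to the functions and to their gradients, both the
  \<open>q\<close>-sum and the energy of the translates split in the limit into the part of \<open>v\<close> and the part of
  the difference to \<open>v\<close>. If \<open>\<theta>\<close> is the sum of \<open>\<bar>v\<bar> powr q\<close>, the definition of \<open>S\<close> applied to both
  parts gives \<open>S * (\<theta> powr (p/q) + (1 - \<theta>) powr (p/q)) \<le> S\<close>. Here \<open>S > 0\<close> (by the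
  Sobolev inequality), \<open>p < q\<close> and \<open>\<theta> > 0\<close> force \<open>\<theta> = 1\<close>; then \<open>v\<close> carries all of the energy, so the energy of the difference tends to \<open>0\<close>.

  Two facts about the function space enter. The Sobolev inequality above the critical exponent is
  proved by comparing dyadic cube averages: the difference of two consecutive averages at scale \<open>m\<close>
  gains a factor \<open>m\<close> from the gradient and loses \<open>m powr (- N * (1/p - 1/r))\<close> from averaging, and
  the resulting geometric series converges exactly when \<open>r\<close> is supercritical. Secondly, a function of
  finite energy in some \<open>\<ell>\<^sup>q\<close> belongs to \<open>D1p\<close> (\<open>D1pI\<close>), because cutting off its small values leaves a
  finitely supported function that is close in energy; so the pointwise limit \<open>v\<close> stays in the space.
\<close>

section \<open>Functions with summable powers\<close>

text \<open>All sums range over a variable set \<open>A\<close>: the same results serve functions on the lattice,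
  gradients (functions on edges), and the restrictions to a finite set and to its complement.\<close>
definition in_lp :: "real \<Rightarrow> 'a set \<Rightarrow> ('a \<Rightarrow> real) \<Rightarrow> bool" where
  "in_lp p A f \<longleftrightarrow> (\<lambda>x. \<bar>f x\<bar> powr p) summable_on A"

definition lp_sum :: "real \<Rightarrow> 'a set \<Rightarrow> ('a \<Rightarrow> real) \<Rightarrow> real" where
  "lp_sum p A f = (\<Sum>\<^sub>\<infinity>x\<in>A. \<bar>f x\<bar> powr p)"

definition lp_norm :: "real \<Rightarrow> 'a set \<Rightarrow> ('a \<Rightarrow> real) \<Rightarrow> real" where
  "lp_norm p A f = lp_sum p A f powr (1 / p)"

lemma lp_sum_nonneg [simp]: "0 \<le> lp_sum p A f"
  unfolding lp_sum_def by (rule infsum_nonneg) simp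

lemma lp_norm_nonneg [simp]: "0 \<le> lp_norm p A f"
  unfolding lp_norm_def by simp

lemma lp_norm_powr: "p > 0 \<Longrightarrow> lp_norm p A f powr p = lp_sum p A f"
  unfolding lp_norm_def by (simp add: powr_powr)

lemma lp_norm_le_iff:
  assumes "p > 0" "M \<ge> 0"
  shows "lp_norm p A f \<le> M \<longleftrightarrow> lp_sum p A f \<le> M powr p"
proof
  assume "lp_norm p A f \<le> M"
  then have "lp_norm p A f powr p \<le> M powr p" using assms by (intro powr_mono2) auto
  then show "lp_sum p A f \<le> M powr p" using assms by (simp add: lp_norm_powr)
next
  assume "lp_sum p A f \<le> M powr p"
  then have "lp_sum p A f powr (1/p) \<le> (M powr p) powr (1/p)" using assms by (intro powr_mono2) auto
  then show "lp_norm p A f \<le> M" using assms by (simp add: lp_norm_def powr_powr)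
qed

lemma in_lp_subset: "in_lp p A f \<Longrightarrow> B \<subseteq> A \<Longrightarrow> in_lp p B f"
  unfolding in_lp_def by (rule summable_on_subset)

lemma lp_sum_subset: "in_lp p A f \<Longrightarrow> B \<subseteq> A \<Longrightarrow> lp_sum p B f \<le> lp_sum p A f"
  unfolding lp_sum_def
  by (rule infsum_mono_neutral) (auto simp: in_lp_def intro: summable_on_subset)

lemma lp_norm_subset: "p > 0 \<Longrightarrow> in_lp p A f \<Longrightarrow> B \<subseteq> A \<Longrightarrow> lp_norm p B f \<le> lp_norm p A f"
  unfolding lp_norm_def by (intro powr_mono2 lp_sum_subset) auto

lemma lp_sum_finite: "finite F \<Longrightarrow> lp_sum p F f = (\<Sum>x\<in>F. \<bar>f x\<bar> powr p)"
  unfolding lp_sum_def by simp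

lemma lp_dominated:
  assumes "in_lp p A g" "\<And>x. x \<in> A \<Longrightarrow> \<bar>f x\<bar> \<le> \<bar>g x\<bar>" "p \<ge> 0"
  shows "in_lp p A f" "lp_sum p A f \<le> lp_sum p A g"
proof -
  have *: "\<bar>f x\<bar> powr p \<le> \<bar>g x\<bar> powr p" if "x \<in> A" for x
    using assms that by (intro powr_mono2) auto
  show "in_lp p A f" using assms(1) unfolding in_lp_def
    by (rule summable_on_comparison_test) (use * in auto)
  then show "lp_sum p A f \<le> lp_sum p A g" using assms(1) * unfolding in_lp_def lp_sum_def
    by (intro infsum_mono) auto
qed

text \<open>Summability and upper bounds both come from finite partial sums, where pointwise limits can be
  taken termwise.\<close>
lemma lp_bounded_finite_sums:
  assumes "\<And>F. finite F \<Longrightarrow> F \<subseteq> A \<Longrightarrow> lp_sum p F f \<le> M"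
  shows "in_lp p A f" "lp_sum p A f \<le> M"
proof -
  have *: "(\<Sum>x\<in>F. \<bar>f x\<bar> powr p) \<le> M" if "finite F" "F \<subseteq> A" for F
    using assms[OF that] that by (simp add: lp_sum_finite)
  show "in_lp p A f" unfolding in_lp_def
    by (rule nonneg_bounded_partial_sums_imp_summable_on[of _ _ M])
       (auto intro!: eventually_finite_subsets_at_top_weakI *)
  then show "lp_sum p A f \<le> M" unfolding lp_sum_def in_lp_def
    by (rule infsum_le_finite_sums) (use * in auto)
qed

lemma lp_Fatou:
  fixes f :: "nat \<Rightarrow> 'a \<Rightarrow> real"
  assumes "p > 0" "\<And>x. x \<in> A \<Longrightarrow> (\<lambda>n. f n x) \<longlonglongrightarrow> g x"
    and "\<And>n. in_lp p A (f n)" and "\<And>n. lp_sum p A (f n) \<le> M n" and "M \<longlonglongrightarrow> L"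
  shows "in_lp p A g" "lp_sum p A g \<le> L"
proof -
  have *: "lp_sum p F g \<le> L" if F: "finite F" "F \<subseteq> A" for F
  proof -
    have "(\<lambda>n. lp_sum p F (f n)) \<longlonglongrightarrow> lp_sum p F g"
      unfolding lp_sum_finite[OF F(1)]
      by (rule tendsto_sum, rule tendsto_powr') (use F assms in \<open>auto intro!: tendsto_intros\<close>)
    moreover have "lp_sum p F (f n) \<le> M n" for n
      using lp_sum_subset[OF assms(3) F(2), of n] assms(4)[of n] by linarith
    ultimately show ?thesis using assms(5) by (intro LIMSEQ_le) auto
  qed
  show "in_lp p A g" "lp_sum p A g \<le> L" using lp_bounded_finite_sums[OF *] by auto
qed

text \<open>The endpoint \<open>0\<close> has to be included because the functions below may vanish at points; there the claim
  reduces to \<open>s powr p \<le> s\<close> for \<open>0 < s < 1\<close>.\<close>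
lemma convex_on_powr_nonneg:
  assumes "p \<ge> 1" shows "convex_on {0..} (\<lambda>x::real. x powr p)"
proof (rule convex_onI)
  fix t x y :: real
  assume t: "0 < t" "t < 1" and xy: "x \<in> {0..}" "y \<in> {0..}"
  have small: "(s * z) powr p \<le> s * z powr p" if "0 < s" "s < 1" "z \<ge> 0" for s z :: real
  proof -
    have "s powr p \<le> s powr 1" using that assms by (intro powr_mono') auto
    then show ?thesis using that by (simp add: powr_mult mult_right_mono)
  qed
  consider "x = 0" | "y = 0" | "x > 0" "y > 0" using xy by fastforce
  then show "((1 - t) *\<^sub>R x + t *\<^sub>R y) powr p \<le> (1 - t) * x powr p + t * y powr p"
  proof cases
    case 3
    then show ?thesis using convex_onD[OF powr_convex[OF assms], of t x y] t by simp
  qed (use small[of t y] small[of "1-t" x] t xy in auto)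
qed simp

lemma powr_sum_Jensen:
  fixes a :: "'b \<Rightarrow> real"
  assumes "p \<ge> 1" "finite Q" "Q \<noteq> {}"
  shows "(\<bar>\<Sum>h\<in>Q. a h\<bar> / card Q) powr p \<le> (\<Sum>h\<in>Q. \<bar>a h\<bar> powr p) / card Q"
proof -
  have c: "real (card Q) > 0" using assms by (simp add: card_gt_0_iff)
  have "\<bar>\<Sum>h\<in>Q. a h\<bar> / card Q \<le> (\<Sum>h\<in>Q. (1 / card Q) *\<^sub>R \<bar>a h\<bar>)"
    using c by (simp add: divide_right_mono flip: sum_divide_distrib)
  then have "(\<bar>\<Sum>h\<in>Q. a h\<bar> / card Q) powr p \<le> (\<Sum>h\<in>Q. (1 / card Q) *\<^sub>R \<bar>a h\<bar>) powr p"
    using assms by (intro powr_mono2) auto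
  also have "\<dots> \<le> (\<Sum>h\<in>Q. (1 / card Q) * \<bar>a h\<bar> powr p)"
    by (rule convex_on_sum[OF assms(2,3) convex_on_powr_nonneg[OF assms(1)]]) (use c in auto)
  also have "\<dots> = (\<Sum>h\<in>Q. \<bar>a h\<bar> powr p) / card Q"
    by (simp add: sum_divide_distrib)
  finally show ?thesis .
qed

text \<open>With \<open>a\<close> and \<open>b\<close> in place of the norms, \<open>f + g\<close> is \<open>a + b\<close> times a convex combination of
  \<open>f / a\<close> and \<open>g / b\<close>, and convexity of the power bounds its \<open>p\<close>-sum by \<open>(a + b) powr p\<close>. Strictly
  positive upper bounds instead of the norms themselves avoid a case distinction for functions of
  norm \<open>0\<close>.\<close>
lemma lp_Minkowski_aux:
  assumes p: "p \<ge> 1" and f: "in_lp p A f" and g: "in_lp p A g"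
    and ab: "a > 0" "b > 0" and "lp_norm p A f \<le> a" "lp_norm p A g \<le> b"
  shows "in_lp p A (\<lambda>x. f x + g x)" "lp_norm p A (\<lambda>x. f x + g x) \<le> a + b"
proof -
  define l where "l = a / (a + b)"
  have l: "0 < l" "l < 1" and l': "1 - l = b / (a + b)" using ab by (auto simp: l_def field_simps)
  let ?c = "(a + b) powr p"
  let ?h = "\<lambda>x. ?c * (l * (\<bar>f x\<bar> powr p / a powr p) + (1 - l) * (\<bar>g x\<bar> powr p / b powr p))"
  have le: "\<bar>f x + g x\<bar> powr p \<le> ?h x" for x
  proof -
    have "(a + b) * (l * (s / a)) = s" "(a + b) * ((1 - l) * (s / b)) = s" for s
      using ab unfolding l' by (simp_all add: l_def)
    then have "(a + b) * (l * (\<bar>f x\<bar> / a) + (1 - l) * (\<bar>g x\<bar> / b)) = \<bar>f x\<bar> + \<bar>g x\<bar>"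
      by (simp add: distrib_left)
    then have "\<bar>f x + g x\<bar> \<le> (a + b) * (l * (\<bar>f x\<bar> / a) + (1 - l) * (\<bar>g x\<bar> / b))"
      using abs_triangle_ineq[of "f x" "g x"] by simp
    then have "\<bar>f x + g x\<bar> powr p \<le> ((a + b) * (l * (\<bar>f x\<bar> / a) + (1 - l) * (\<bar>g x\<bar> / b))) powr p"
      using p by (intro powr_mono2) auto
    also have "\<dots> = ?c * (l * (\<bar>f x\<bar> / a) + (1 - l) * (\<bar>g x\<bar> / b)) powr p"
      using ab l by (simp add: powr_mult)
    also have "\<dots> \<le> ?c * (l * (\<bar>f x\<bar> / a) powr p + (1 - l) * (\<bar>g x\<bar> / b) powr p)"
      using convex_onD[OF convex_on_powr_nonneg[OF p], of "1-l" "\<bar>f x\<bar> / a" "\<bar>g x\<bar> / b"] l ab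
      by (intro mult_left_mono) auto
    also have "\<dots> = ?h x" using ab by (simp add: powr_divide)
    finally show ?thesis .
  qed
  have "((\<lambda>x. \<bar>f x\<bar> powr p) has_sum lp_sum p A f) A" "((\<lambda>x. \<bar>g x\<bar> powr p) has_sum lp_sum p A g) A"
    using f g by (simp_all add: in_lp_def lp_sum_def)
  then have hs: "(?h has_sum (?c * (l * (lp_sum p A f / a powr p) + (1 - l) * (lp_sum p A g / b powr p)))) A"
    unfolding divide_inverse
    by (intro has_sum_cmult_right has_sum_add has_sum_cmult_left)
  show in_lp: "in_lp p A (\<lambda>x. f x + g x)" unfolding in_lp_def
    by (rule summable_on_comparison_test[OF has_sum_imp_summable[OF hs]]) (use le in auto)
  have "lp_sum p A (\<lambda>x. f x + g x) \<le> ?c * (l * (lp_sum p A f / a powr p) + (1 - l) * (lp_sum p A g / b powr p))"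
  proof (rule has_sum_mono[OF _ hs])
    show "((\<lambda>x. \<bar>f x + g x\<bar> powr p) has_sum lp_sum p A (\<lambda>x. f x + g x)) A"
      using in_lp by (simp add: in_lp_def lp_sum_def)
  qed (rule le)
  also have "\<dots> \<le> ?c * (l * 1 + (1 - l) * 1)"
    using assms l by (intro mult_left_mono add_mono) (auto simp: lp_norm_le_iff)
  finally show "lp_norm p A (\<lambda>x. f x + g x) \<le> a + b" using ab p by (simp add: lp_norm_le_iff)
qed

lemma lp_Minkowski:
  assumes "p \<ge> 1" "in_lp p A f" "in_lp p A g"
  shows "in_lp p A (\<lambda>x. f x + g x)" "lp_norm p A (\<lambda>x. f x + g x) \<le> lp_norm p A f + lp_norm p A g"
proof -
  have pos: "lp_norm p A f + e > 0" if "e > 0" for e f using that lp_norm_nonneg[of p A f] by linarith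
  show "in_lp p A (\<lambda>x. f x + g x)"
    by (rule lp_Minkowski_aux(1)[OF assms, of "lp_norm p A f + 1" "lp_norm p A g + 1"]) (use pos in auto)
  show "lp_norm p A (\<lambda>x. f x + g x) \<le> lp_norm p A f + lp_norm p A g"
  proof (rule field_le_epsilon)
    fix e :: real assume "e > 0"
    then show "lp_norm p A (\<lambda>x. f x + g x) \<le> lp_norm p A f + lp_norm p A g + e"
      using lp_Minkowski_aux(2)[OF assms, of "lp_norm p A f + e/2" "lp_norm p A g + e/2"] pos[of "e/2"] by simp
  qed
qed

lemma lp_scale:
  assumes "p > 0"
  shows "in_lp p A f \<Longrightarrow> in_lp p A (\<lambda>x. c * f x)" "lp_sum p A (\<lambda>x. c * f x) = \<bar>c\<bar> powr p * lp_sum p A f"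
    "lp_norm p A (\<lambda>x. c * f x) = \<bar>c\<bar> * lp_norm p A f"
proof -
  show "in_lp p A f \<Longrightarrow> in_lp p A (\<lambda>x. c * f x)"
    unfolding in_lp_def by (simp add: abs_mult powr_mult summable_on_cmult_right)
  show *: "lp_sum p A (\<lambda>x. c * f x) = \<bar>c\<bar> powr p * lp_sum p A f"
    unfolding lp_sum_def by (simp add: abs_mult powr_mult infsum_cmult_right')
  show "lp_norm p A (\<lambda>x. c * f x) = \<bar>c\<bar> * lp_norm p A f"
    unfolding lp_norm_def * using assms by (simp add: powr_mult powr_powr)
qed

lemma lp_uminus [simp]:
  "in_lp p A (\<lambda>x. - f x) = in_lp p A f" "lp_norm p A (\<lambda>x. - f x) = lp_norm p A f"
  by (simp_all add: in_lp_def lp_norm_def lp_sum_def)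

lemma lp_diff:
  assumes "p \<ge> 1" "in_lp p A f" "in_lp p A g"
  shows "in_lp p A (\<lambda>x. f x - g x)" "lp_norm p A (\<lambda>x. f x - g x) \<le> lp_norm p A f + lp_norm p A g"
    "\<bar>lp_norm p A f - lp_norm p A g\<bar> \<le> lp_norm p A (\<lambda>x. f x - g x)"
proof -
  show d: "in_lp p A (\<lambda>x. f x - g x)" "lp_norm p A (\<lambda>x. f x - g x) \<le> lp_norm p A f + lp_norm p A g"
    using lp_Minkowski[of p A f "\<lambda>x. - g x"] assms by simp_all
  have d': "in_lp p A (\<lambda>x. g x - f x)" "lp_norm p A (\<lambda>x. g x - f x) = lp_norm p A (\<lambda>x. f x - g x)"
    using d(1) lp_uminus[of p A "\<lambda>x. f x - g x"] by simp_all
  show "\<bar>lp_norm p A f - lp_norm p A g\<bar> \<le> lp_norm p A (\<lambda>x. f x - g x)"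
    using lp_Minkowski(2)[OF assms(1) d(1) assms(3)] lp_Minkowski(2)[OF assms(1) d'(1) assms(2)] d'(2) by simp
qed

lemma lp_Minkowski_sum:
  assumes "p \<ge> 1" "finite Q" "\<And>h. h \<in> Q \<Longrightarrow> in_lp p A (f h)"
  shows "in_lp p A (\<lambda>x. \<Sum>h\<in>Q. f h x) \<and> lp_norm p A (\<lambda>x. \<Sum>h\<in>Q. f h x) \<le> (\<Sum>h\<in>Q. lp_norm p A (f h))"
  using assms(2,3)
proof (induction Q)
  case empty
  then show ?case by (simp add: in_lp_def lp_norm_def lp_sum_def)
next
  case (insert h Q)
  have "in_lp p A (\<lambda>x. \<Sum>h\<in>Q. f h x)" and le: "lp_norm p A (\<lambda>x. \<Sum>h\<in>Q. f h x) \<le> (\<Sum>h\<in>Q. lp_norm p A (f h))"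
    using insert by auto
  from lp_Minkowski[OF assms(1) insert.prems[of h] this(1)] le show ?case
    using insert.hyps by simp
qed

lemma lp_reindex:
  assumes "bij_betw g A B"
  shows "in_lp p A (\<lambda>x. f (g x)) = in_lp p B f" "lp_sum p A (\<lambda>x. f (g x)) = lp_sum p B f"
    "lp_norm p A (\<lambda>x. f (g x)) = lp_norm p B f"
  using summable_on_reindex_bij_betw[OF assms, of "\<lambda>x. \<bar>f x\<bar> powr p"]
    infsum_reindex_bij_betw[OF assms, of "\<lambda>x. \<bar>f x\<bar> powr p"]
  by (simp_all add: in_lp_def lp_sum_def lp_norm_def)

lemma lp_member_le:
  assumes "p > 0" "in_lp p A f" "x \<in> A"
  shows "\<bar>f x\<bar> powr p \<le> lp_sum p A f" "\<bar>f x\<bar> \<le> lp_norm p A f"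
proof -
  show *: "\<bar>f x\<bar> powr p \<le> lp_sum p A f"
    using lp_sum_subset[OF assms(2), of "{x}"] assms(3) by (simp add: lp_sum_finite)
  have "(\<bar>f x\<bar> powr p) powr (1/p) \<le> lp_norm p A f"
    unfolding lp_norm_def by (intro powr_mono2 *) (use assms in auto)
  then show "\<bar>f x\<bar> \<le> lp_norm p A f" using assms by (simp add: powr_powr)
qed

text \<open>Split \<open>\<bar>f x\<bar> powr r\<close> as \<open>\<bar>f x\<bar> powr (r - p) * \<bar>f x\<bar> powr p\<close> and bound the first factor by the supremum.\<close>
lemma lp_interpolation_sup:
  assumes "0 < p" "p \<le> r" "in_lp p A f" "\<And>x. x \<in> A \<Longrightarrow> \<bar>f x\<bar> \<le> M"
  shows "in_lp r A f" "lp_sum r A f \<le> M powr (r - p) * lp_sum p A f"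
proof -
  have *: "\<bar>f x\<bar> powr r \<le> M powr (r - p) * \<bar>f x\<bar> powr p" if "x \<in> A" for x
  proof -
    have "\<bar>f x\<bar> powr r = \<bar>f x\<bar> powr (r - p) * \<bar>f x\<bar> powr p" by (simp flip: powr_add)
    also have "\<dots> \<le> M powr (r - p) * \<bar>f x\<bar> powr p"
      using assms that by (intro mult_right_mono powr_mono2) auto
    finally show ?thesis .
  qed
  have s: "(\<lambda>x. M powr (r - p) * \<bar>f x\<bar> powr p) summable_on A"
    using assms(3) unfolding in_lp_def by (rule summable_on_cmult_right)
  show "in_lp r A f" unfolding in_lp_def
    by (rule summable_on_comparison_test[OF s]) (use * in auto)
  then have "lp_sum r A f \<le> (\<Sum>\<^sub>\<infinity>x\<in>A. M powr (r - p) * \<bar>f x\<bar> powr p)"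
    unfolding in_lp_def lp_sum_def by (rule infsum_mono[OF _ s]) (use * in auto)
  then show "lp_sum r A f \<le> M powr (r - p) * lp_sum p A f"
    by (simp add: lp_sum_def infsum_cmult_right')
qed

lemma lp_sum_split:
  assumes "in_lp p A f" "F \<subseteq> A"
  shows "lp_sum p A f = lp_sum p F f + lp_sum p (A - F) f"
proof -
  have "lp_sum p (F \<union> (A - F)) f = lp_sum p F f + lp_sum p (A - F) f"
    using in_lp_subset[OF assms] in_lp_subset[OF assms(1), of "A - F"]
    unfolding lp_sum_def in_lp_def by (intro infsum_Un_disjoint) auto
  then show ?thesis using assms(2) by (simp add: Un_absorb1)
qed

lemma lp_small_tail:
  assumes "in_lp p A f" "e > 0"
  obtains F where "finite F" "F \<subseteq> A" "lp_sum p (A - F) f \<le> e"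
proof -
  obtain F where F: "finite F" "F \<subseteq> A" "dist (\<Sum>x\<in>F. \<bar>f x\<bar> powr p) (lp_sum p A f) \<le> e"
    using infsum_finite_approximation[of "\<lambda>x. \<bar>f x\<bar> powr p" A e] assms
    unfolding in_lp_def lp_sum_def by blast
  then show ?thesis using lp_sum_split[OF assms(1) F(2)]
    by (intro that[of F]) (auto simp: lp_sum_finite dist_real_def)
qed

lemma lp_dominated_tendsto_0:
  fixes f :: "nat \<Rightarrow> 'a \<Rightarrow> real"
  assumes "p > 0" "in_lp p A g" and dom: "\<And>n x. x \<in> A \<Longrightarrow> \<bar>f n x\<bar> \<le> \<bar>g x\<bar>"
    and lim: "\<And>x. x \<in> A \<Longrightarrow> (\<lambda>n. f n x) \<longlonglongrightarrow> 0"
  shows "(\<lambda>n. lp_sum p A (f n)) \<longlonglongrightarrow> 0"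
proof (rule LIMSEQ_I)
  fix e :: real assume e: "e > 0"
  obtain F where F: "finite F" "F \<subseteq> A" and tail: "lp_sum p (A - F) g \<le> e/2"
    using lp_small_tail[OF assms(2), of "e/2"] e by auto
  have "(\<lambda>n. lp_sum p F (f n)) \<longlonglongrightarrow> (\<Sum>x\<in>F. \<bar>0\<bar> powr p)"
    unfolding lp_sum_finite[OF F(1)]
    by (intro tendsto_sum tendsto_powr' tendsto_rabs tendsto_const lim) (use F assms in auto)
  then have "(\<lambda>n. lp_sum p F (f n)) \<longlonglongrightarrow> 0" by simp
  then obtain n0 where n0: "\<And>n. n \<ge> n0 \<Longrightarrow> \<bar>lp_sum p F (f n)\<bar> < e/2"
    using LIMSEQ_D[of _ _ "e/2"] e by fastforce
  have f: "in_lp p A (f n)" for n using lp_dominated(1)[OF assms(2) dom] assms(1) by simp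
  have "lp_sum p (A - F) (f n) \<le> lp_sum p (A - F) g" for n
    using lp_dominated(2)[OF in_lp_subset[OF assms(2), of "A - F"], of "f n"] dom assms(1) by auto
  then have "lp_sum p A (f n) < e" if "n \<ge> n0" for n
    using n0[OF that] tail lp_sum_split[OF f[of n] F(2)] by (smt (verit) field_sum_of_halves)
  then show "\<exists>no. \<forall>n\<ge>no. norm (lp_sum p A (f n) - 0) < e" by auto
qed

text \<open>Off a large finite set \<open>g\<close> has small norm, so there \<open>f n\<close> and \<open>f n - g\<close> have nearly equal norms by the
  triangle inequality, hence nearly equal \<open>p\<close>-sums, as the norms stay in a bounded interval. On the finite
  set the pointwise convergence suffices. This argument covers \<open>p = 1\<close> as well.\<close>
lemma Brezis_Lieb:
  fixes f :: "nat \<Rightarrow> 'a \<Rightarrow> real"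
  assumes p: "p \<ge> 1" and lim: "\<And>x. x \<in> A \<Longrightarrow> (\<lambda>n. f n x) \<longlonglongrightarrow> g x"
    and f: "\<And>n. in_lp p A (f n)" and bd: "\<And>n. lp_norm p A (f n) \<le> M" and g: "in_lp p A g"
  shows "(\<lambda>n. lp_sum p A (f n) - lp_sum p A (\<lambda>x. f n x - g x)) \<longlonglongrightarrow> lp_sum p A g"
proof (rule LIMSEQ_I)
  fix e :: real assume e: "e > 0"
  have p0: "p > 0" using p by simp
  \<comment> \<open>All norms below lie in the interval from \<open>0\<close> to \<open>R\<close>, where the power is uniformly continuous.\<close>
  define R where "R = M + lp_norm p A g"
  have "M \<ge> 0" using bd[of 0] lp_norm_nonneg[of p A "f 0"] by linarith
  have "continuous_on {0..R} (\<lambda>t::real. t powr p)"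
    using p by (intro continuous_on_powr') (auto intro!: continuous_intros)
  then have "uniformly_continuous_on {0..R} (\<lambda>t::real. t powr p)"
    by (rule compact_uniformly_continuous) simp
  then obtain d where d: "d > 0" "\<And>s t. s \<in> {0..R} \<Longrightarrow> t \<in> {0..R} \<Longrightarrow> \<bar>s - t\<bar> < d \<Longrightarrow> \<bar>s powr p - t powr p\<bar> < e/4"
    unfolding uniformly_continuous_on_def dist_real_def using e by (metis divide_pos_pos zero_less_numeral)
  obtain F where F: "finite F" "F \<subseteq> A" and tail: "lp_sum p (A - F) g \<le> min (e/4) ((d/2) powr p)"
    using lp_small_tail[OF g, of "min (e/4) ((d/2) powr p)"] e d(1) by auto
  have tailn: "lp_norm p (A - F) g \<le> d/2" using tail d(1) p0 lp_norm_le_iff[of p "d/2" "A - F" g] by simp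
  have "(\<lambda>n. lp_sum p F (f n) - lp_sum p F (\<lambda>x. f n x - g x)) \<longlonglongrightarrow>
          lp_sum p F g - (\<Sum>x\<in>F. \<bar>g x - g x\<bar> powr p)"
    unfolding lp_sum_finite[OF F(1)]
    by (intro tendsto_diff tendsto_sum tendsto_powr' tendsto_rabs tendsto_const lim) (use F p in auto)
  then have "(\<lambda>n. lp_sum p F (f n) - lp_sum p F (\<lambda>x. f n x - g x)) \<longlonglongrightarrow> lp_sum p F g" using p by simp
  then obtain n0 where n0: "\<And>n. n \<ge> n0 \<Longrightarrow> \<bar>lp_sum p F (f n) - lp_sum p F (\<lambda>x. f n x - g x) - lp_sum p F g\<bar> < e/4"
    using LIMSEQ_D[of _ _ "e/4"] e by fastforce
  show "\<exists>no. \<forall>n\<ge>no. norm (lp_sum p A (f n) - lp_sum p A (\<lambda>x. f n x - g x) - lp_sum p A g) < e"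
  proof (intro exI allI impI)
    fix n assume n: "n \<ge> n0"
    let ?B = "A - F" and ?h = "\<lambda>x. f n x - g x"
    have hA: "in_lp p A ?h" using lp_diff(1)[OF p f g] .
    have B: "in_lp p ?B (f n)" "in_lp p ?B g" "in_lp p ?B ?h"
      using in_lp_subset[OF f, of ?B] in_lp_subset[OF g, of ?B] in_lp_subset[OF hA, of ?B] by auto
    have "\<bar>lp_norm p ?B (f n) - lp_norm p ?B ?h\<bar> \<le> lp_norm p ?B g"
      using lp_diff(3)[OF p B(1) B(3)] by simp
    also have "\<dots> < d" using tailn d(1) by simp
    finally have close: "\<bar>lp_norm p ?B (f n) - lp_norm p ?B ?h\<bar> < d" .
    have "lp_norm p ?B (f n) \<le> R"
      using lp_norm_subset[OF p0 f, of ?B] bd[of n] lp_norm_nonneg[of p A g]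
      unfolding R_def by (smt (verit) Diff_subset)
    moreover have "lp_norm p ?B ?h \<le> R"
      using lp_norm_subset[OF p0 hA, of ?B] lp_diff(2)[OF p f g, of n] bd[of n]
      unfolding R_def by (smt (verit) Diff_subset)
    ultimately have "\<bar>lp_norm p ?B (f n) powr p - lp_norm p ?B ?h powr p\<bar> < e/4"
      using d(2) close by simp
    then have "\<bar>lp_sum p ?B (f n) - lp_sum p ?B ?h\<bar> < e/4" using p0 by (simp add: lp_norm_powr)
    moreover have "lp_sum p ?B g \<le> e/4" "0 \<le> lp_sum p ?B g" using tail by auto
    ultimately show "norm (lp_sum p A (f n) - lp_sum p A ?h - lp_sum p A g) < e"
      using n0[OF n] e lp_sum_split[OF f F(2), of n] lp_sum_split[OF g F(2)] lp_sum_split[OF hA F(2)]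
      unfolding real_norm_def by linarith
  qed
qed

section \<open>The gradient as a function on edges\<close>

text \<open>Both orientations of an edge occur, which matches the double sum over ordered pairs of neighbours
  in the energy.\<close>
definition edges :: "((int ^ 'n::finite) \<times> (int ^ 'n)) set" where
  "edges = {(x, y). lattice_adj x y}"

definition grad :: "(int ^ 'n::finite \<Rightarrow> real) \<Rightarrow> (int ^ 'n) \<times> (int ^ 'n) \<Rightarrow> real" where
  "grad u = (\<lambda>(x, y). u y - u x)"

lemma grad_apply [simp]: "grad u (x, y) = u y - u x"
  by (simp add: grad_def)

lemma grad_diff: "grad (\<lambda>x. u x - v x) = (\<lambda>e. grad u e - grad v e)"
  by (auto simp: grad_def fun_eq_iff)

lemma edges_Sigma: "edges = Sigma UNIV (\<lambda>x. {y. lattice_adj x y})"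
  by (auto simp: edges_def)

lemma finite_energy_iff_in_lp:
  "finite_energy p u \<longleftrightarrow> in_lp p edges (grad u)"
proof
  assume "in_lp p edges (grad u)"
  then show "finite_energy p u"
    using summable_on_Sigma_banach[of "\<lambda>x y. \<bar>u y - u x\<bar> powr p" UNIV "\<lambda>x. {y. lattice_adj x y}"]
    by (simp add: in_lp_def edges_Sigma finite_energy_def grad_def case_prod_beta' finite_lattice_nbhd)
next
  assume "finite_energy p u"
  then show "in_lp p edges (grad u)"
    unfolding in_lp_def edges_Sigma finite_energy_def
    by (intro summable_on_SigmaI) (auto intro!: has_sum_finiteI finite_lattice_nbhd)
qed

lemma D1p_norm_eq_lp_norm:
  assumes "finite_energy p u"
  shows "D1p_norm p u = lp_norm p edges (grad u)"
proof -
  have "(\<Sum>\<^sub>\<infinity>x. \<Sum>y | lattice_adj x y. \<bar>u y - u x\<bar> powr p) = lp_sum p edges (grad u)"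
    using assms infsum_Sigma'_banach[of "\<lambda>x y. \<bar>u y - u x\<bar> powr p" UNIV "\<lambda>x. {y. lattice_adj x y}"]
    by (simp add: finite_energy_iff_in_lp in_lp_def lp_sum_def edges_Sigma grad_def case_prod_beta' finite_lattice_nbhd)
  then show ?thesis by (simp add: D1p_norm_def lp_norm_def)
qed

lemma lq_norm_eq_lp_norm: "lq_norm q u = lp_norm q UNIV u"
  by (simp add: lq_norm_def lp_norm_def lp_sum_def)

lemma bij_shift: "bij_betw (\<lambda>x::int^'n::finite. x + h) UNIV UNIV"
  by (rule bij_betw_byWitness[where f' = "\<lambda>x. x - h"]) auto

lemmas lp_shift = lp_reindex[OF bij_shift]

lemma bij_shift_edges: "bij_betw (\<lambda>(x, y). (x + h, y + h)) edges (edges :: ((int^'n::finite) \<times> _) set)"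
  by (rule bij_betw_byWitness[where f' = "\<lambda>(x, y). (x - h, y - h)"]) (auto simp: edges_def lattice_adj_def)

lemma grad_shift: "grad (\<lambda>x. u (x + h)) = (\<lambda>e. grad u (case e of (x, y) \<Rightarrow> (x + h, y + h)))"
  by (auto simp: fun_eq_iff)

lemma finite_energy_shift: "finite_energy p (\<lambda>x. u (x + h)) = finite_energy p u"
  by (simp add: finite_energy_iff_in_lp grad_shift lp_reindex[OF bij_shift_edges])

lemma grad_norm_shift: "lp_norm p edges (grad (\<lambda>x. u (x + h))) = lp_norm p edges (grad u)"
  by (simp add: grad_shift lp_reindex[OF bij_shift_edges])

lemma finite_support_in_lp: "finite {x. u x \<noteq> 0} \<Longrightarrow> in_lp p UNIV u"
  unfolding in_lp_def by (rule finite_nonzero_values_imp_summable_on) simp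

lemma finite_support_finite_energy:
  fixes u :: "int ^ 'n::finite \<Rightarrow> real"
  assumes "finite {x. u x \<noteq> 0}"
  shows "finite_energy p u"
proof -
  let ?S = "{x. u x \<noteq> 0}"
  have sym: "lattice_adj x y \<longleftrightarrow> lattice_adj y x" for x y :: "int ^ 'n"
    by (simp add: lattice_adj_def abs_minus_commute)
  have "{e \<in> edges. \<bar>grad u e\<bar> powr p \<noteq> 0} \<subseteq>
      (\<Union>x\<in>?S. {x} \<times> {y. lattice_adj x y}) \<union> (\<Union>y\<in>?S. {x. lattice_adj y x} \<times> {y})"
    by (auto simp: edges_def sym)
  moreover have "finite \<dots>" using assms finite_lattice_nbhd by auto
  ultimately show ?thesis unfolding finite_energy_iff_in_lp in_lp_def
    by (intro finite_nonzero_values_imp_summable_on) (rule finite_subset)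
qed

section \<open>A supercritical Sobolev inequality\<close>

text \<open>The bounds on translation errors are composed along lattice paths; membership in \<open>\<ell>\<^sup>p\<close>
  has to be carried along, since \<open>lp_norm\<close> is meaningless without it.\<close>
definition shift_diff_le :: "real \<Rightarrow> (int ^ 'n::finite \<Rightarrow> real) \<Rightarrow> int ^ 'n \<Rightarrow> real \<Rightarrow> bool" where
  "shift_diff_le p u h a \<longleftrightarrow>
     in_lp p UNIV (\<lambda>x. u (x + h) - u x) \<and> lp_norm p UNIV (\<lambda>x. u (x + h) - u x) \<le> a"

lemma shift_diff_le_0: "shift_diff_le p u 0 0"
  by (simp add: shift_diff_le_def in_lp_def lp_norm_def lp_sum_def)

lemma shift_diff_le_add:
  assumes "p \<ge> 1" "shift_diff_le p u h a" "shift_diff_le p u h' b"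
  shows "shift_diff_le p u (h + h') (a + b)"
proof -
  let ?d = "\<lambda>h x. u (x + h) - u x"
  have "in_lp p UNIV (\<lambda>x. ?d h' (x + h))" "lp_norm p UNIV (\<lambda>x. ?d h' (x + h)) \<le> b"
    using assms(3) lp_shift(1,3)[where f = "?d h'"] by (auto simp: shift_diff_le_def)
  moreover have "in_lp p UNIV (?d h)" "lp_norm p UNIV (?d h) \<le> a"
    using assms(2) by (auto simp: shift_diff_le_def)
  moreover have "?d (h + h') = (\<lambda>x. ?d h x + ?d h' (x + h))" by (auto simp: fun_eq_iff add.assoc)
  ultimately show ?thesis using lp_Minkowski[OF assms(1), of UNIV "?d h" "\<lambda>x. ?d h' (x + h)"]
    by (simp add: shift_diff_le_def)
qed

text \<open>The edges in direction \<open>k\<close> with one orientation form a subset of all edges, so this part of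
  the gradient has at most the full norm.\<close>
lemma shift_diff_le_unit:
  fixes u :: "int ^ 'n::finite \<Rightarrow> real"
  assumes "p > 0" "finite_energy p u"
  shows "shift_diff_le p u (axis k 1) (lp_norm p edges (grad u))"
proof -
  let ?g = "\<lambda>x::int^'n. (x, x + axis k 1)"
  have inj: "bij_betw ?g UNIV (range ?g)" by (auto simp: bij_betw_def inj_def)
  have "(\<Sum>j\<in>UNIV. \<bar>axis k (1::int) $ j\<bar>) = (\<Sum>j\<in>UNIV. if j = k then 1 else 0)"
    by (intro sum.cong) (auto simp: axis_def)
  then have "range ?g \<subseteq> edges" by (auto simp: edges_def lattice_adj_def)
  moreover have "in_lp p edges (grad u)" using assms by (simp add: finite_energy_iff_in_lp)
  ultimately have "in_lp p (range ?g) (grad u)" "lp_norm p (range ?g) (grad u) \<le> lp_norm p edges (grad u)"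
    using in_lp_subset lp_norm_subset assms(1) by blast+
  then show ?thesis using lp_reindex(1,3)[OF inj, of p "grad u"] by (simp add: shift_diff_le_def)
qed

lemma shift_diff_le_axis:
  fixes u :: "int ^ 'n::finite \<Rightarrow> real"
  assumes "p \<ge> 1" "finite_energy p u"
  shows "shift_diff_le p u (axis k (int m)) (real m * lp_norm p edges (grad u))"
proof (induction m)
  case 0
  have "axis k (int 0) = (0 :: int ^ 'n)" by (simp add: vec_eq_iff axis_def)
  then show ?case using shift_diff_le_0[of p u] by (simp only: of_nat_0 mult_zero_left)
next
  case (Suc m)
  have "axis k (int (Suc m)) = axis k (int m) + axis k 1"
    by (auto simp: vec_eq_iff axis_def)
  then show ?case
    using shift_diff_le_add[OF assms(1) Suc.IH shift_diff_le_unit[OF _ assms(2), of k]] assms(1)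
    by (simp add: algebra_simps)
qed

lemma shift_diff_le_sum:
  assumes "p \<ge> 1" "finite_energy p u" "finite K"
  shows "shift_diff_le p u (\<Sum>k\<in>K. axis k (int (c k))) (real (\<Sum>k\<in>K. c k) * lp_norm p edges (grad u))"
  using assms(3)
proof (induction K)
  case empty
  then show ?case using shift_diff_le_0[of p u] by simp
next
  case (insert k K)
  then show ?case
    using shift_diff_le_add[OF assms(1) shift_diff_le_axis[OF assms(1,2)] insert.IH, of k "c k"]
    by (simp add: algebra_simps)
qed

definition cube :: "nat \<Rightarrow> (int ^ 'n::finite) set" where
  "cube m = {h. \<forall>k. 0 \<le> h $ k \<and> h $ k < int m}"

definition cube_avg :: "nat \<Rightarrow> (int ^ 'n::finite \<Rightarrow> real) \<Rightarrow> int ^ 'n \<Rightarrow> real" where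
  "cube_avg m u x = (\<Sum>h\<in>cube m. u (x + h)) / real (card (cube m :: (int ^ 'n) set))"

text \<open>A cube of side \<open>2 * m\<close> consists of the translates of a cube of side \<open>m\<close> by the vectors \<open>int m *s e\<close>, with \<open>e\<close>
  in \<open>cube 2\<close>. Averaging over these offsets is what turns an average at scale \<open>m\<close> into one at
  scale \<open>2 * m\<close>.\<close>
definition corner_avg :: "nat \<Rightarrow> (int ^ 'n::finite \<Rightarrow> real) \<Rightarrow> int ^ 'n \<Rightarrow> real" where
  "corner_avg m u x = (\<Sum>e\<in>cube 2. u (x + int m *s e)) / real (card (cube 2 :: (int ^ 'n) set))"

lemma bij_cube: "bij_betw vec_lambda (PiE UNIV (\<lambda>_::'n::finite. {0..<int m})) (cube m)"
  by (rule bij_betw_byWitness[where f' = vec_nth]) (auto simp: cube_def vec_lambda_inverse PiE_iff Pi_iff)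

lemma card_cube: "card (cube m :: (int ^ 'n::finite) set) = m ^ CARD('n)"
  using bij_betw_same_card[OF bij_cube[of m, where 'n = 'n]] by (simp add: card_PiE)

lemma finite_cube [simp]: "finite (cube m)"
  using bij_betw_finite[OF bij_cube] by (simp add: finite_PiE)

lemma cube_nonempty: "m > 0 \<Longrightarrow> cube m \<noteq> {}"
  by (auto simp: cube_def intro!: exI[of _ 0])

text \<open>Coordinatewise division with remainder by \<open>m\<close> is the inverse.\<close>
lemma bij_cube_double:
  assumes "m > 0"
  shows "bij_betw (\<lambda>(e, h). int m *s e + h) (cube 2 \<times> cube m) (cube (2 * m) :: (int ^ 'n::finite) set)"
proof -
  let ?f = "\<lambda>(e, h). int m *s e + h :: int ^ 'n"
  let ?g = "\<lambda>h :: int ^ 'n. (\<chi> k. h $ k div int m, \<chi> k. h $ k mod int m)"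
  have 1: "\<forall>a\<in>cube 2 \<times> cube m. ?g (?f a) = a"
    using assms by (auto simp: cube_def vec_eq_iff)
  have 2: "\<forall>h\<in>cube (2 * m). ?f (?g h) = h"
    by (auto simp: vec_eq_iff)
  have "int m * a + b < 2 * int m" if "a < 2" "b < int m" for a b
  proof -
    have "int m * a \<le> int m * 1" using that by (intro mult_left_mono) auto
    then show ?thesis using that by linarith
  qed
  then have 3: "?f ` (cube 2 \<times> cube m) \<subseteq> cube (2 * m)"
    by (auto simp: cube_def)
  have "a div int m < 2" if "a < 2 * int m" for a
  proof (rule ccontr)
    assume "\<not> a div int m < 2"
    then have "2 * int m \<le> a div int m * int m" by (intro mult_right_mono) auto
    also have "\<dots> \<le> a" using div_mult_mod_eq[of a "int m"] assms pos_mod_sign[of "int m" a] by linarith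
    finally show False using that by simp
  qed
  then have 4: "?g ` cube (2 * m) \<subseteq> cube 2 \<times> cube m"
    using assms by (auto simp: cube_def pos_imp_zdiv_nonneg_iff)
  from 1 2 3 4 show ?thesis by (rule bij_betw_byWitness)
qed

lemma cube_avg_double:
  fixes u :: "int ^ 'n::finite \<Rightarrow> real"
  assumes "m > 0"
  shows "cube_avg (2 * m) u x = cube_avg m (corner_avg m u) x"
proof -
  have "(\<Sum>h\<in>cube (2 * m). u (x + h)) = (\<Sum>(e, h)\<in>cube 2 \<times> cube m. u (x + (int m *s e + h)))"
    using sum.reindex_bij_betw[OF bij_cube_double[OF assms], of "\<lambda>h. u (x + h)"] by (simp add: case_prod_beta')
  also have "\<dots> = (\<Sum>h\<in>cube m. \<Sum>e\<in>cube 2. u (x + h + int m *s e))"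
    by (subst sum.swap) (simp add: sum.cartesian_product add_ac)
  finally show ?thesis
    by (simp add: cube_avg_def corner_avg_def card_cube power_mult_distrib flip: sum_divide_distrib)
qed

lemma cube_avg_1: "cube_avg (Suc 0) u = u" for u :: "int ^ 'n::finite \<Rightarrow> real"
proof -
  have "cube (Suc 0) = {0 :: int ^ 'n}" 
    by (auto simp: cube_def vec_eq_iff) (metis int_one_le_iff_zero_less linorder_not_less order_le_imp_less_or_eq)
  then show ?thesis by (simp add: cube_avg_def fun_eq_iff)
qed

lemma cube_avg_diff: "cube_avg m (\<lambda>x. u x - v x) x = cube_avg m u x - cube_avg m v x"
  by (simp add: cube_avg_def sum_subtractf diff_divide_distrib)

text \<open>Each offset is reached by at most \<open>N * m\<close> unit steps, and a unit step costs at most the norm of the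
  gradient.\<close>
lemma corner_avg_error:
  fixes u :: "int ^ 'n::finite \<Rightarrow> real"
  assumes "p \<ge> 1" "finite_energy p u"
  shows "in_lp p UNIV (\<lambda>x. u x - corner_avg m u x)"
    "lp_norm p UNIV (\<lambda>x. u x - corner_avg m u x) \<le> real CARD('n) * real m * lp_norm p edges (grad u)"
proof -
  let ?Q = "cube 2 :: (int ^ 'n) set"
  let ?B = "real CARD('n) * real m * lp_norm p edges (grad u)"
  let ?d = "\<lambda>e x. u (x + int m *s e) - u x"
  have c: "real (card ?Q) > 0" by (simp add: card_cube)
  have e: "in_lp p UNIV (?d e)" "lp_norm p UNIV (?d e) \<le> ?B" if "e \<in> ?Q" for e
  proof -
    let ?c = "\<lambda>k. nat (int m * e $ k)"
    have e01: "0 \<le> e $ k" "e $ k \<le> 1" for k using that by (auto simp: cube_def dest: spec[of _ k])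
    have "int m *s e = (\<Sum>k\<in>UNIV. axis k (int (?c k)))"
      using e01 by (simp add: vec_eq_iff sum_component axis_def sum.delta)
    then have "shift_diff_le p u (int m *s e) (real (\<Sum>k\<in>UNIV. ?c k) * lp_norm p edges (grad u))"
      using shift_diff_le_sum[OF assms, of UNIV ?c] by simp
    moreover have "?c k \<le> m" for k
      using mult_left_mono[OF e01(2), of "int m" k] by simp
    then have "(\<Sum>k\<in>UNIV. ?c k) \<le> CARD('n) * m"
      using sum_bounded_above[of "UNIV :: 'n set" ?c m] by simp
    then have "real (\<Sum>k\<in>UNIV. ?c k) \<le> real CARD('n) * real m"
      by (metis of_nat_le_iff of_nat_mult)
    then have "real (\<Sum>k\<in>UNIV. ?c k) * lp_norm p edges (grad u) \<le> ?B"
      by (intro mult_right_mono) simp_all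
    ultimately show "in_lp p UNIV (?d e)" "lp_norm p UNIV (?d e) \<le> ?B"
      unfolding shift_diff_le_def by linarith+
  qed
  have eq: "u x - corner_avg m u x = (- 1 / card ?Q) * (\<Sum>e\<in>?Q. ?d e x)" for x
    using c cube_nonempty[of 2, where 'a = 'n] by (simp add: corner_avg_def sum_subtractf right_diff_distrib)
  have M: "in_lp p UNIV (\<lambda>x. \<Sum>e\<in>?Q. ?d e x) \<and>
      lp_norm p UNIV (\<lambda>x. \<Sum>e\<in>?Q. ?d e x) \<le> (\<Sum>e\<in>?Q. lp_norm p UNIV (?d e))"
    by (intro lp_Minkowski_sum assms(1) finite_cube e(1))
  show "in_lp p UNIV (\<lambda>x. u x - corner_avg m u x)"
    unfolding eq using M assms(1) by (intro lp_scale(1)) auto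
  have "lp_norm p UNIV (\<lambda>x. u x - corner_avg m u x) = (1 / card ?Q) * lp_norm p UNIV (\<lambda>x. \<Sum>e\<in>?Q. ?d e x)"
    unfolding eq using assms(1) by (subst lp_scale(3)) auto
  also have "\<dots> \<le> (1 / card ?Q) * (\<Sum>e\<in>?Q. lp_norm p UNIV (?d e))"
    using M by (intro mult_left_mono) auto
  also have "\<dots> \<le> (1 / card ?Q) * (real (card ?Q) * ?B)"
    by (intro mult_left_mono sum_bounded_above e(2)) auto
  also have "\<dots> = ?B" using c cube_nonempty[of 2, where 'a = 'n] by simp
  finally show "lp_norm p UNIV (\<lambda>x. u x - corner_avg m u x) \<le> ?B" .
qed

text \<open>Averaging does not increase the \<open>p\<close>-norm, and by Jensen's inequality its values are at most
  the \<open>p\<close>-norm divided by the \<open>p\<close>-th root of the number \<open>m ^ N\<close> of points of the cube. Interpolating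
  between these two bounds gives the \<open>r\<close>-norm.\<close>
lemma cube_avg_smoothing:
  fixes g :: "int ^ 'n::finite \<Rightarrow> real"
  assumes "p \<ge> 1" "p \<le> r" "in_lp p UNIV g" "m > 0"
  shows "in_lp r UNIV (cube_avg m g)"
    "lp_norm r UNIV (cube_avg m g) \<le> lp_norm p UNIV g * real m powr (- real CARD('n) * (1 / p - 1 / r))"
proof -
  let ?Q = "cube m :: (int ^ 'n) set"
  let ?G = "lp_norm p UNIV g" and ?N = "real CARD('n)"
  define M where "M = ?G * real m powr (- ?N / p)"
  have c: "real (card ?Q) > 0" using assms(4) by (simp add: card_cube)
  have sh: "in_lp p UNIV (\<lambda>x. g (x + h))" "lp_norm p UNIV (\<lambda>x. g (x + h)) = ?G" for h
    using assms(3) by (simp_all add: lp_shift)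
  have Mk: "in_lp p UNIV (\<lambda>x. \<Sum>h\<in>?Q. g (x + h)) \<and>
      lp_norm p UNIV (\<lambda>x. \<Sum>h\<in>?Q. g (x + h)) \<le> (\<Sum>h\<in>?Q. lp_norm p UNIV (\<lambda>x. g (x + h)))"
    by (intro lp_Minkowski_sum assms(1) finite_cube sh(1))
  have eq: "cube_avg m g = (\<lambda>x. (1 / card ?Q) * (\<Sum>h\<in>?Q. g (x + h)))" by (simp add: cube_avg_def fun_eq_iff)
  have in_p: "in_lp p UNIV (cube_avg m g)" unfolding eq using Mk assms(1) by (intro lp_scale(1)) auto
  have "lp_norm p UNIV (cube_avg m g) = (1 / card ?Q) * lp_norm p UNIV (\<lambda>x. \<Sum>h\<in>?Q. g (x + h))"
    unfolding eq using assms(1) by (subst lp_scale(3)) auto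
  also have "\<dots> \<le> (1 / card ?Q) * (\<Sum>h\<in>?Q. ?G)"
    using Mk by (intro mult_left_mono) (auto simp: sh(2))
  also have "\<dots> = ?G" using c cube_nonempty[OF assms(4), where 'a = 'n] by simp
  finally have np: "lp_sum p UNIV (cube_avg m g) \<le> ?G powr p"
    using assms(1) by (simp add: lp_norm_le_iff)
  have sup: "\<bar>cube_avg m g x\<bar> \<le> M" for x
  proof -
    have inj: "bij_betw (\<lambda>h. x + h) ?Q ((\<lambda>h. x + h) ` ?Q)" by (auto simp: bij_betw_def)
    have "\<bar>cube_avg m g x\<bar> powr p \<le> (\<Sum>h\<in>?Q. \<bar>g (x + h)\<bar> powr p) / card ?Q"
      using powr_sum_Jensen[OF assms(1) finite_cube cube_nonempty[OF assms(4)], of "\<lambda>h. g (x + h)"]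
      by (simp add: cube_avg_def)
    also have "(\<Sum>h\<in>?Q. \<bar>g (x + h)\<bar> powr p) = lp_sum p ((\<lambda>h. x + h) ` ?Q) g"
      using lp_reindex(2)[OF inj, of p g] by (simp add: lp_sum_finite)
    also have "\<dots> \<le> lp_sum p UNIV g" using assms(3) by (intro lp_sum_subset) auto
    also have "\<dots> = ?G powr p" using assms(1) by (simp add: lp_norm_powr)
    also have "?G powr p / card ?Q = ?G powr p * real m powr (- ?N)"
      using assms(4) by (simp add: card_cube powr_minus_divide powr_realpow)
    also have "\<dots> = (?G * real m powr (- ?N / p)) powr p"
      using assms(1) by (simp only: powr_mult powr_powr) simp
    finally have "\<bar>cube_avg m g x\<bar> powr p \<le> M powr p" by (simp add: M_def divide_right_mono)
    moreover have "M \<ge> 0" by (simp add: M_def)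
    ultimately show ?thesis
      using powr_less_mono2[of p M "\<bar>cube_avg m g x\<bar>"] assms(1) by fastforce
  qed
  have p0: "0 < p" using assms(1) by simp
  note I = lp_interpolation_sup[OF p0 assms(2) in_p sup]
  show "in_lp r UNIV (cube_avg m g)" using I(1) by simp
  have "lp_sum r UNIV (cube_avg m g) \<le> M powr (r - p) * lp_sum p UNIV (cube_avg m g)" using I(2) by simp
  also have "\<dots> \<le> M powr (r - p) * ?G powr p" using np by (intro mult_left_mono) auto
  also have "\<dots> = ?G powr r * (real m powr (- ?N / p)) powr (r - p)"
    by (simp add: M_def powr_mult mult_ac flip: powr_add)
  also have "(real m powr (- ?N / p)) powr (r - p) = (real m powr (- ?N * (1 / p - 1 / r))) powr r"
  proof -
    have "(- ?N / p) * (r - p) = (- ?N * (1 / p - 1 / r)) * r"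
      using assms(1,2) by (simp add: field_simps)
    then show ?thesis by (simp only: powr_powr)
  qed
  finally have "lp_sum r UNIV (cube_avg m g) \<le> (?G * real m powr (- ?N * (1 / p - 1 / r))) powr r"
    by (simp add: powr_mult)
  then show "lp_norm r UNIV (cube_avg m g) \<le> ?G * real m powr (- ?N * (1 / p - 1 / r))"
    using assms(1,2) by (subst lp_norm_le_iff) auto
qed

text \<open>Telescope \<open>u\<close> into its average at scale \<open>2 ^ J\<close>, whose \<open>r\<close>-norm tends to \<open>0\<close>, and the differences of
  consecutive dyadic averages. The difference at scale \<open>2 ^ j\<close> is the average of the error of
  \<open>corner_avg\<close>, so its norm is at most a constant times \<open>\<rho> ^ j\<close>, where \<open>\<rho> < 1\<close> because of the
  condition on \<open>r\<close>. The norm \<open>lp_norm p UNIV u\<close> occurs only in the vanishing term.\<close>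
lemma Sobolev_in_lp:
  fixes u :: "int ^ 'n::finite \<Rightarrow> real"
  assumes "p \<ge> 1" "p \<le> r" and gap: "real CARD('n) * (1 / p - 1 / r) > 1"
    and "finite_energy p u" "in_lp p UNIV u"
  shows "lp_norm r UNIV u \<le>
    real CARD('n) / (1 - 2 powr (1 - real CARD('n) * (1 / p - 1 / r))) * lp_norm p edges (grad u)"
proof -
  let ?N = "real CARD('n)" and ?D = "lp_norm p edges (grad u)"
  define a where "a = ?N * (1 / p - 1 / r)"
  \<comment> \<open>The ratio \<open>\<rho> = 2 * \<kappa>\<close> combines the growth \<open>2\<close> of the translation error per scale with the gain \<open>\<kappa>\<close> from averaging.\<close>
  define \<rho> :: real where "\<rho> = 2 powr (1 - a)"
  define \<kappa> :: real where "\<kappa> = 2 powr (- a)"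
  have a: "a > 1" using gap by (simp add: a_def)
  have \<rho>: "0 < \<rho>" "\<rho> < 1" using a powr_less_mono[of "1-a" 0 "2::real"] by (auto simp: \<rho>_def)
  have \<kappa>: "0 < \<kappa>" "\<kappa> < 1" using a powr_less_mono[of "-a" 0 "2::real"] by (auto simp: \<kappa>_def)
  have pw: "real (2 ^ j) powr b = (2 powr b) ^ j" for j b
    by (simp add: powr_power powr_powr mult.commute flip: powr_realpow)
  have r1: "r \<ge> 1" using assms by simp
  define b where "b j = (\<lambda>x. u x - corner_avg (2 ^ j) u x)" for j
  have b: "in_lp p UNIV (b j)" "lp_norm p UNIV (b j) \<le> ?N * 2 ^ j * ?D" for j
    using corner_avg_error[OF assms(1,4), of "2 ^ j"] by (simp_all add: b_def)
  have incr: "in_lp r UNIV (cube_avg (2 ^ j) (b j))" "lp_norm r UNIV (cube_avg (2 ^ j) (b j)) \<le> ?N * ?D * \<rho> ^ j" for j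
  proof -
    note S = cube_avg_smoothing[OF assms(1,2) b(1), of "2 ^ j" j]
    show "in_lp r UNIV (cube_avg (2 ^ j) (b j))" using S(1) by simp
    have "lp_norm r UNIV (cube_avg (2 ^ j) (b j)) \<le> lp_norm p UNIV (b j) * \<kappa> ^ j"
      using S(2) pw[of j "-a"] by (simp add: a_def \<kappa>_def)
    also have "\<dots> \<le> (?N * 2 ^ j * ?D) * \<kappa> ^ j" using b(2) \<kappa> by (intro mult_right_mono) auto
    also have "\<dots> = ?N * ?D * (2 * \<kappa>) ^ j" by (simp add: power_mult_distrib)
    also have "2 * \<kappa> = \<rho>" by (simp add: \<kappa>_def \<rho>_def powr_diff powr_minus_divide)
    finally show "lp_norm r UNIV (cube_avg (2 ^ j) (b j)) \<le> ?N * ?D * \<rho> ^ j" .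
  qed
  have bound: "lp_norm r UNIV u \<le> lp_norm p UNIV u * \<kappa> ^ J + ?N / (1 - \<rho>) * ?D" for J
  proof -
    have tel: "u x = cube_avg (2 ^ J) u x + (\<Sum>j<J. cube_avg (2 ^ j) (b j) x)" for x
    proof (induction J)
      case 0
      then show ?case using cube_avg_1[of u] by simp
    next
      case (Suc J)
      have "cube_avg (2 ^ J) (b J) x = cube_avg (2 ^ J) u x - cube_avg (2 ^ Suc J) u x"
        using cube_avg_double[of "2 ^ J" u x] by (simp add: b_def cube_avg_diff)
      then show ?case using Suc.IH by simp
    qed
    note S = cube_avg_smoothing[OF assms(1,2,5), of "2 ^ J"]
    have M: "in_lp r UNIV (\<lambda>x. \<Sum>j<J. cube_avg (2 ^ j) (b j) x) \<and>
        lp_norm r UNIV (\<lambda>x. \<Sum>j<J. cube_avg (2 ^ j) (b j) x) \<le> (\<Sum>j<J. lp_norm r UNIV (cube_avg (2 ^ j) (b j)))"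
      by (intro lp_Minkowski_sum r1 finite_lessThan incr(1))
    have "lp_norm r UNIV u = lp_norm r UNIV (\<lambda>x. cube_avg (2 ^ J) u x + (\<Sum>j<J. cube_avg (2 ^ j) (b j) x))"
      by (rule arg_cong[where f = "lp_norm r UNIV"]) (use tel in \<open>simp add: fun_eq_iff\<close>)
    also have "\<dots> \<le> lp_norm r UNIV (cube_avg (2 ^ J) u) + lp_norm r UNIV (\<lambda>x. \<Sum>j<J. cube_avg (2 ^ j) (b j) x)"
      using S(1) M by (intro lp_Minkowski(2)[OF r1]) auto
    also have "\<dots> \<le> lp_norm p UNIV u * \<kappa> ^ J + (\<Sum>j<J. ?N * ?D * \<rho> ^ j)"
    proof (rule add_mono)
      show "lp_norm r UNIV (cube_avg (2 ^ J) u) \<le> lp_norm p UNIV u * \<kappa> ^ J"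
        using S(2) pw[of J "-a"] by (simp add: a_def \<kappa>_def)
      show "lp_norm r UNIV (\<lambda>x. \<Sum>j<J. cube_avg (2 ^ j) (b j) x) \<le> (\<Sum>j<J. ?N * ?D * \<rho> ^ j)"
        using M incr(2) by (meson order_trans sum_mono)
    qed
    also have "(\<Sum>j<J. ?N * ?D * \<rho> ^ j) \<le> ?N * ?D * (1 / (1 - \<rho>))"
      unfolding sum_distrib_left[symmetric] using \<rho>
      by (intro mult_left_mono) (auto simp: sum_gp_strict divide_right_mono)
    finally show ?thesis by (simp add: mult_ac)
  qed
  have "(\<lambda>J. lp_norm p UNIV u * \<kappa> ^ J + ?N / (1 - \<rho>) * ?D) \<longlonglongrightarrow> lp_norm p UNIV u * 0 + ?N / (1 - \<rho>) * ?D"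
    using \<kappa> by (intro tendsto_intros LIMSEQ_realpow_zero) auto
  from LIMSEQ_le_const[OF this] bound show ?thesis by (auto simp: \<rho>_def a_def)
qed

section \<open>The space $D^{1,p}$\<close>

lemma D1p_finite_energy:
  assumes "p \<ge> 1" "u \<in> D1p p"
  shows "finite_energy p u"
proof -
  obtain \<phi> where \<phi>: "finite {x. \<phi> (0::nat) x \<noteq> 0}" "finite_energy p (\<lambda>x. \<phi> 0 x - u x)"
    using assms(2) by (auto simp: D1p_def D1p_converges_def)
  have "in_lp p edges (\<lambda>e. grad (\<phi> 0) e - grad (\<lambda>x. \<phi> 0 x - u x) e)"
    using \<phi> finite_support_finite_energy by (intro lp_diff(1)[OF assms(1)]) (auto simp: finite_energy_iff_in_lp)
  moreover have "(\<lambda>e. grad (\<phi> 0) e - grad (\<lambda>x. \<phi> 0 x - u x) e) = grad u"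
    by (auto simp: grad_def fun_eq_iff)
  ultimately show ?thesis by (simp add: finite_energy_iff_in_lp)
qed

text \<open>Finitely supported functions lie in every \<open>\<ell>\<^sup>p\<close>; the constant does not depend on the function,
  so the inequality passes to their limits by Fatou's lemma.\<close>
lemma D1p_Sobolev:
  assumes p: "p \<ge> 1" "p \<le> r" and gap: "real CARD('n::finite) * (1 / p - 1 / r) > 1"
  obtains C where "C > 0" and
    "\<And>u :: int ^ 'n \<Rightarrow> real. u \<in> D1p p \<Longrightarrow> in_lp r UNIV u \<and> lp_norm r UNIV u \<le> C * lp_norm p edges (grad u)"
proof -
  define C where "C = real CARD('n) / (1 - 2 powr (1 - real CARD('n) * (1 / p - 1 / r)))"
  have "2 powr (1 - real CARD('n) * (1 / p - 1 / r)) < (1::real)"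
    using gap powr_less_mono[of "1 - real CARD('n) * (1 / p - 1 / r)" 0 "2::real"] by simp
  then have C: "C > 0" by (simp add: C_def)
  have "in_lp r UNIV u \<and> lp_norm r UNIV u \<le> C * lp_norm p edges (grad u)"
    if u: "u \<in> D1p p" for u :: "int ^ 'n \<Rightarrow> real"
  proof -
    let ?D = "lp_norm p edges (grad u)"
    obtain \<phi> where fin: "\<And>k. finite {x. \<phi> k x \<noteq> 0}" and lim: "\<And>x. (\<lambda>k. \<phi> k x) \<longlonglongrightarrow> u x"
      and fe: "\<And>k. finite_energy p (\<lambda>x. \<phi> k x - u x)" and conv: "(\<lambda>k. D1p_norm p (\<lambda>x. \<phi> k x - u x)) \<longlonglongrightarrow> 0"
      using u by (auto simp: D1p_def D1p_converges_def)
    let ?\<delta> = "\<lambda>k. lp_norm p edges (grad (\<lambda>x. \<phi> k x - u x))"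
    have \<delta>: "?\<delta> \<longlonglongrightarrow> 0" using conv by (simp add: D1p_norm_eq_lp_norm[OF fe])
    have fu: "in_lp p edges (grad u)" and f\<phi>: "in_lp p edges (grad (\<phi> k))" for k
      using D1p_finite_energy[OF p(1) u] finite_support_finite_energy[OF fin] by (simp_all add: finite_energy_iff_in_lp)
    have bd: "lp_sum r UNIV (\<phi> k) \<le> (C * (?D + ?\<delta> k)) powr r" for k
    proof -
      have "lp_norm r UNIV (\<phi> k) \<le> C * lp_norm p edges (grad (\<phi> k))"
        unfolding C_def using finite_support_finite_energy[OF fin] finite_support_in_lp[OF fin]
        by (intro Sobolev_in_lp p gap) auto
      also have "\<dots> \<le> C * (?D + ?\<delta> k)"
        using lp_diff(3)[OF p(1) f\<phi>[of k] fu] C by (intro mult_left_mono) (auto simp: grad_diff)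
      finally show ?thesis using p C by (subst (asm) lp_norm_le_iff) auto
    qed
    have "(\<lambda>k. (C * (?D + ?\<delta> k)) powr r) \<longlonglongrightarrow> (C * (?D + 0)) powr r"
      using p C by (intro tendsto_powr' tendsto_mult tendsto_add tendsto_const \<delta>) auto
    then have "(\<lambda>k. (C * (?D + ?\<delta> k)) powr r) \<longlonglongrightarrow> (C * ?D) powr r" by simp
    from lp_Fatou[OF _ lim finite_support_in_lp[OF fin] bd this]
    show ?thesis using p C by (auto simp: lp_norm_le_iff)
  qed
  with C show ?thesis using that by blast
qed

lemma D1p_converges_iff_lp_sum:
  assumes "p > 0" "\<And>k. finite_energy p (\<lambda>x. f k x - u x)"
  shows "D1p_converges p f u \<longleftrightarrow> (\<lambda>k. lp_sum p edges (grad (\<lambda>x. f k x - u x))) \<longlonglongrightarrow> 0"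
proof -
  let ?s = "\<lambda>k. lp_sum p edges (grad (\<lambda>x. f k x - u x))" and ?n = "\<lambda>k. lp_norm p edges (grad (\<lambda>x. f k x - u x))"
  have "?s \<longlonglongrightarrow> 0" if "?n \<longlonglongrightarrow> 0"
    using tendsto_powr'[OF that tendsto_const[of p]] assms(1) by (simp add: lp_norm_powr)
  moreover have "?n \<longlonglongrightarrow> 0" if "?s \<longlonglongrightarrow> 0"
    using tendsto_powr'[OF that tendsto_const[of "1/p"]] assms(1) by (simp add: lp_norm_def)
  ultimately show ?thesis
    using assms(2) by (auto simp: D1p_converges_def D1p_norm_eq_lp_norm)
qed

lemma in_lp_finite_superlevel:
  assumes "q > 0" "in_lp q A u" "e > 0"
  shows "finite {x \<in> A. \<bar>u x\<bar> > e}"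
proof -
  obtain F where F: "finite F" "F \<subseteq> A" "lp_sum q (A - F) u \<le> e powr q"
    using lp_small_tail[OF assms(2), of "e powr q"] assms(3) by auto
  have "\<bar>u x\<bar> \<le> e" if "x \<in> A - F" for x
    using lp_member_le(2)[OF assms(1) in_lp_subset[OF assms(2)], of "A - F" x] that F(3) assms
    by (auto simp flip: lp_norm_le_iff)
  then have "{x \<in> A. \<bar>u x\<bar> > e} \<subseteq> F" by force
  then show ?thesis using F(1) finite_subset by blast
qed

text \<open>Subtract from \<open>u\<close> its clamping to \<open>[-d, d]\<close>. What remains lives where \<open>\<bar>u\<bar> > d\<close>, a finite set. The
  error is the clamped function: its gradient is dominated by that of \<open>u\<close>, as clamping is \<open>1\<close>-Lipschitz,
  and tends to \<open>0\<close> pointwise as \<open>d\<close> does.\<close>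
lemma D1pI:
  fixes u :: "int ^ 'n::finite \<Rightarrow> real"
  assumes p: "p > 0" and q: "q > 0" and fe: "finite_energy p u" and u: "in_lp q UNIV u"
  shows "u \<in> D1p p"
proof -
  define e where "e k = 1 / real (Suc k)" for k
  define clamp :: "real \<Rightarrow> real \<Rightarrow> real" where "clamp d t = max (- d) (min d t)" for d t
  define \<phi> where "\<phi> k x = u x - clamp (e k) (u x)" for k x
  have e: "e k > 0" for k by (simp add: e_def)
  have e0: "e \<longlonglongrightarrow> 0" unfolding e_def by (rule LIMSEQ_inverse_real_of_nat[unfolded inverse_eq_divide])
  have small: "\<bar>clamp (e k) t\<bar> \<le> e k" for k t using e[of k] by (auto simp: clamp_def)
  have lip: "\<bar>clamp d s - clamp d t\<bar> \<le> \<bar>s - t\<bar>" for d s t by (auto simp: clamp_def)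
  have c0: "(\<lambda>k. clamp (e k) t) \<longlonglongrightarrow> 0" for t
    by (rule Lim_null_comparison[OF _ e0]) (simp add: small)
  have "{x. \<phi> k x \<noteq> 0} \<subseteq> {x \<in> UNIV. \<bar>u x\<bar> > e k}" for k
    using e[of k] by (auto simp: \<phi>_def clamp_def)
  then have fin: "finite {x. \<phi> k x \<noteq> 0}" for k
    using in_lp_finite_superlevel[OF q u e[of k]] finite_subset by blast
  have lim: "(\<lambda>k. \<phi> k x) \<longlonglongrightarrow> u x" for x
    unfolding \<phi>_def using tendsto_diff[OF tendsto_const c0[of "u x"]] by simp
  have g: "\<bar>grad (\<lambda>x. \<phi> k x - u x) z\<bar> \<le> \<bar>grad u z\<bar>" for k z
    using lip[of "e k" "u (fst z)" "u (snd z)"] by (cases z) (simp add: \<phi>_def abs_minus_commute)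
  have fu: "in_lp p edges (grad u)" using fe by (simp add: finite_energy_iff_in_lp)
  have fe': "finite_energy p (\<lambda>x. \<phi> k x - u x)" for k
    unfolding finite_energy_iff_in_lp using lp_dominated(1)[OF fu g] p by simp
  have "(\<lambda>k. lp_sum p edges (grad (\<lambda>x. \<phi> k x - u x))) \<longlonglongrightarrow> 0"
  proof (rule lp_dominated_tendsto_0[OF p fu g])
    fix z :: "(int ^ 'n) \<times> (int ^ 'n)"
    show "(\<lambda>k. grad (\<lambda>x. \<phi> k x - u x) z) \<longlonglongrightarrow> 0"
      using tendsto_diff[OF c0[of "u (fst z)"] c0[of "u (snd z)"]] by (cases z) (simp add: \<phi>_def)
  qed
  then have "D1p_converges p \<phi> u" using D1p_converges_iff_lp_sum[OF p fe'] by simp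
  with fin lim show ?thesis by (auto simp: D1p_def)
qed

section \<open>Compactness of minimizing sequences\<close>

text \<open>Translates supercriticality into the condition that makes the geometric series in
  \<open>Sobolev_in_lp\<close> converge.\<close>
lemma supercritical_gap:
  fixes N p r :: real
  assumes "1 \<le> p" "p < N" "r > N * p / (N - p)"
  shows "N * (1 / p - 1 / r) > 1" "p \<le> r"
proof -
  have "p * (N - p) \<le> N * p" using assms by (simp add: algebra_simps)
  then have "p \<le> N * p / (N - p)" using assms by (simp add: pos_le_divide_eq)
  then show "p \<le> r" using assms by simp
  then have pos: "p > 0" "r > 0" using assms by auto
  have "N * p < r * (N - p)" using assms by (simp add: pos_divide_less_eq)
  then show "N * (1 / p - 1 / r) > 1" using pos by (simp add: field_simps)
qed

text \<open>Homogeneous form of the definition of the infimum. It remains true for \<open>w = 0\<close>, so that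
  it can be applied to differences that may vanish.\<close>
lemma sobolev_const_le:
  fixes w :: "int ^ 'n::finite \<Rightarrow> real"
  assumes "p > 0" "q > 0" "finite_energy p w" "in_lp q UNIV w"
  shows "sobolev_const TYPE('n) p q * lp_norm q UNIV w powr p \<le> lp_sum p edges (grad w)"
proof (cases "lp_norm q UNIV w = 0")
  case False
  define a where "a = lp_norm q UNIV w"
  have a: "a > 0" using False lp_norm_nonneg[of q UNIV w] unfolding a_def by linarith
  let ?w = "\<lambda>x. (1 / a) * w x"
  have g: "grad ?w = (\<lambda>e. (1 / a) * grad w e)" by (auto simp: grad_def fun_eq_iff right_diff_distrib diff_divide_distrib)
  have fe: "finite_energy p ?w" unfolding finite_energy_iff_in_lp g
    using assms by (intro lp_scale(1)) (auto simp: finite_energy_iff_in_lp)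
  then have "?w \<in> D1p p" using lp_scale(1)[OF assms(2,4)] by (intro D1pI[OF assms(1,2)])
  moreover have "lq_norm q ?w = 1"
    unfolding lq_norm_eq_lp_norm using a assms(2) by (subst lp_scale(3)) (auto simp: a_def)
  ultimately have "sobolev_const TYPE('n) p q \<le> D1p_norm p ?w powr p"
    unfolding sobolev_const_def by (intro cInf_lower) (auto intro!: bdd_belowI[of _ 0])
  also have "\<dots> = lp_sum p edges (grad w) / a powr p"
    unfolding D1p_norm_eq_lp_norm[OF fe] lp_norm_powr[OF assms(1)] g lp_scale(2)[OF assms(1)]
    using a by (simp add: powr_divide)
  finally show ?thesis using a by (simp add: a_def pos_le_divide_eq)
qed simp

lemma uniformly_nonvanishing:
  fixes u :: "nat \<Rightarrow> 'a \<Rightarrow> real"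
  assumes "0 < r" "r < q" and "\<And>n. in_lp r UNIV (u n)" "\<And>n. lp_sum r UNIV (u n) \<le> K"
    and "\<And>n. lp_sum q UNIV (u n) = 1"
  obtains c where "c > 0" "\<And>n. \<exists>x. \<bar>u n x\<bar> > c"
proof -
  have K: "K \<ge> 0" using assms(4)[of 0] lp_sum_nonneg[of r UNIV "u 0"] by linarith
  \<comment> \<open>Chosen so that \<open>c powr (q - r) * K < 1\<close>: a function bounded by \<open>c\<close> would have \<open>q\<close>-sum below \<open>1\<close>.\<close>
  define c where "c = (1 / (K + 1)) powr (1 / (q - r))"
  have c: "c > 0" "c powr (q - r) = 1 / (K + 1)" using K assms(2) by (simp_all add: c_def powr_powr)
  have "\<exists>x. \<bar>u n x\<bar> > c" for n
  proof (rule ccontr)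
    assume "\<nexists>x. \<bar>u n x\<bar> > c"
    then have "\<bar>u n x\<bar> \<le> c" for x by (meson linorder_not_less)
    then have "lp_sum q UNIV (u n) \<le> c powr (q - r) * lp_sum r UNIV (u n)"
      using assms by (intro lp_interpolation_sup(2)) auto
    also have "\<dots> \<le> 1 / (K + 1) * K" unfolding c(2) using K assms(4) by (intro mult_left_mono) auto
    also have "\<dots> < 1" using K by simp
    finally show False using assms(5)[of n] by simp
  qed
  with c(1) that show ?thesis by blast
qed

text \<open>A power with exponent below \<open>1\<close> exceeds its argument on the open unit interval, so
  splitting the unit mass into two positive parts strictly increases the sum of the powers.\<close>
lemma powr_strict_concave_split:
  fixes t s :: real
  assumes "0 < s" "s < 1" "0 < t" "t \<le> 1" "t powr s + (1 - t) powr s \<le> 1"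
  shows "t = 1"
proof (rule ccontr)
  assume "t \<noteq> 1"
  have *: "z < z powr s" if "0 < z" "z < 1" for z
    using powr_less_mono'[of z s 1] that assms by simp
  show False using *[of t] *[of "1 - t"] assms \<open>t \<noteq> 1\<close> by simp
qed

theorem theorem1:
  fixes p q :: real and u :: "nat \<Rightarrow> int ^ 'n::finite \<Rightarrow> real"
  assumes "CARD('n) \<ge> 3"
    and "1 \<le> p" and "p < real CARD('n)"
    and "q > real CARD('n) * p / (real CARD('n) - p)"
    and "\<And>n. u n \<in> D1p p"
    and "\<And>n. lq_norm q (u n) = 1"
    and "(\<lambda>n. D1p_norm p (u n) powr p) \<longlonglongrightarrow> sobolev_const TYPE('n) p q"
  shows "\<exists>i :: nat \<Rightarrow> int ^ 'n. \<exists>\<sigma> :: nat \<Rightarrow> nat. \<exists>v \<in> D1p p.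
           strict_mono \<sigma> \<and>
           D1p_converges p (\<lambda>k x. u (\<sigma> k) (x + i (\<sigma> k))) v \<and>
           lq_norm q v = 1 \<and>
           D1p_norm p v powr p = sobolev_const TYPE('n) p q"
proof -
  let ?N = "real CARD('n)" and ?S = "sobolev_const TYPE('n) p q"
  define E where "E w = lp_sum p edges (grad w)" for w :: "int ^ 'n \<Rightarrow> real"
  note gap_q = supercritical_gap[OF assms(2-4)]
  have p0: "p > 0" and q0: "q > 0" and q1: "q \<ge> 1" using assms(2) gap_q by auto
  have pq: "p < q"
  proof (rule ccontr)
    assume "\<not> p < q"
    then have "p = q" using gap_q(2) by simp
    then show False using gap_q(1) by simp
  qed

  \<comment> \<open>The energies are bounded because they converge. The Sobolev inequality for \<open>q\<close> bounds them below, so the infimum is positive.\<close>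
  have fe: "finite_energy p (u n)" for n using D1p_finite_energy assms(2,5) .
  have Eu: "(\<lambda>n. E (u n)) \<longlonglongrightarrow> ?S"
    using assms(7) by (simp add: E_def D1p_norm_eq_lp_norm[OF fe] lp_norm_powr[OF p0])
  obtain B where B: "E (u n) \<le> B powr p" "B > 0" for n
  proof -
    have "Bseq (\<lambda>n. E (u n))" using Eu by (intro convergent_imp_Bseq convergentI)
    then obtain K where K: "K > 0" "\<And>n. norm (E (u n)) \<le> K" unfolding Bseq_def by auto
    have "E (u n) \<le> (K powr (1 / p)) powr p" for n using K(2)[of n] K(1) p0 by (simp add: powr_powr)
    then show ?thesis using that[of "K powr (1 / p)"] K(1) by simp
  qed
  obtain Cq where Cq: "Cq > 0" "\<And>w :: int ^ 'n \<Rightarrow> real. w \<in> D1p p \<Longrightarrow>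
      in_lp q UNIV w \<and> lp_norm q UNIV w \<le> Cq * lp_norm p edges (grad w)"
    using D1p_Sobolev[OF assms(2) gap_q(2,1)] by metis
  have uq: "in_lp q UNIV (u n)" "lp_norm q UNIV (u n) = 1" "lp_sum q UNIV (u n) = 1" for n
    using Cq(2)[OF assms(5)] assms(6)[of n] lp_norm_powr[OF q0, of UNIV "u n"]
    by (auto simp: lq_norm_eq_lp_norm)
  have S: "?S > 0"
  proof -
    have "(1 / Cq) powr p \<le> E (u n)" for n
    proof -
      have "1 / Cq \<le> lp_norm p edges (grad (u n))"
        using Cq(2)[OF assms(5)[of n]] uq(2)[of n] Cq(1) by (simp add: pos_divide_le_eq mult.commute)
      then have "(1 / Cq) powr p \<le> lp_norm p edges (grad (u n)) powr p"
        using Cq(1) p0 by (intro powr_mono2) auto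
      then show ?thesis by (simp add: E_def lp_norm_powr[OF p0])
    qed
    then have "(1 / Cq) powr p \<le> ?S" using LIMSEQ_le_const[OF Eu] by blast
    then show ?thesis using Cq(1) by (smt (verit) powr_gt_zero zero_less_divide_iff)
  qed

  \<comment> \<open>An exponent strictly between the critical one and \<open>q\<close> excludes vanishing; the translates \<open>w n\<close> are large at the origin.\<close>
  obtain r where r: "r > ?N * p / (?N - p)" "r < q" using dense[OF assms(4)] by blast
  note gap_r = supercritical_gap[OF assms(2,3) r(1)]
  have r0: "r > 0" using gap_r p0 by simp
  obtain Cr where Cr: "Cr > 0" "\<And>w :: int ^ 'n \<Rightarrow> real. w \<in> D1p p \<Longrightarrow>
      in_lp r UNIV w \<and> lp_norm r UNIV w \<le> Cr * lp_norm p edges (grad w)"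
    using D1p_Sobolev[OF assms(2) gap_r(2,1)] by metis
  have ur: "in_lp r UNIV (u n)" "lp_sum r UNIV (u n) \<le> (Cr * B) powr r" for n
  proof -
    show "in_lp r UNIV (u n)" using Cr(2)[OF assms(5)] by simp
    have "lp_norm p edges (grad (u n)) \<le> B"
      using B(1)[of n] B(2) p0 by (simp add: lp_norm_le_iff E_def)
    then have "Cr * lp_norm p edges (grad (u n)) \<le> Cr * B" using Cr(1) by simp
    then have "lp_norm r UNIV (u n) \<le> Cr * B" using Cr(2)[OF assms(5)[of n]] by linarith
    then show "lp_sum r UNIV (u n) \<le> (Cr * B) powr r"
      using Cr(1) B(2) r0 by (subst (asm) lp_norm_le_iff) auto
  qed
  obtain c where c: "c > 0" "\<And>n. \<exists>x. \<bar>u n x\<bar> > c"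
    using uniformly_nonvanishing[where u = u, OF r0 r(2) ur uq(3)] by metis
  then obtain i where i: "\<And>n. \<bar>u n (i n)\<bar> > c" by metis
  define w where "w n = (\<lambda>x. u n (x + i n))" for n
  have wq: "in_lp q UNIV (w n)" "lp_norm q UNIV (w n) = 1" "lp_sum q UNIV (w n) = 1" for n
    using uq[of n] by (simp_all add: w_def lp_shift)
  have few: "finite_energy p (w n)" for n using fe[of n] by (simp add: w_def finite_energy_shift)
  have Ew: "E (w n) = E (u n)" for n
    using grad_norm_shift[of p "u n" "i n"] by (simp add: E_def w_def flip: lp_norm_powr[OF p0])

  \<comment> \<open>The values of the translates are bounded by \<open>1\<close>, so a diagonal subsequence converges at all lattice points.\<close>
  have bounded: "norm (w n x) \<le> 1" for n x
    using lp_member_le(2)[OF q0 wq(1), of x n] wq(2) by simp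
  obtain \<sigma> where \<sigma>: "strict_mono \<sigma>" and "\<And>x. x \<in> UNIV \<Longrightarrow> \<exists>l. (\<lambda>n. w (\<sigma> n) x) \<longlonglongrightarrow> l"
    by (rule function_convergent_subsequence[of UNIV w 1, OF _ bounded]) simp_all
  then obtain v where lim: "\<And>x. (\<lambda>n. w (\<sigma> n) x) \<longlonglongrightarrow> v x" by (metis UNIV_I)
  have glim: "(\<lambda>n. grad (w (\<sigma> n)) z) \<longlonglongrightarrow> grad v z" for z
    by (cases z) (auto intro!: tendsto_diff lim)
  have gw: "in_lp p edges (grad (w n))" for n using few by (simp add: finite_energy_iff_in_lp)
  have Es: "(\<lambda>n. E (w (\<sigma> n))) \<longlonglongrightarrow> ?S"
    using LIMSEQ_subseq_LIMSEQ[OF Eu \<sigma>] by (simp add: Ew o_def)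
  have gv: "in_lp p edges (grad v)"
    by (rule lp_Fatou(1)[OF p0 glim gw _ Es]) (simp add: E_def)
  then have fev: "finite_energy p v" by (simp add: finite_energy_iff_in_lp)
  have vq: "in_lp q UNIV v" and vq1: "lp_sum q UNIV v \<le> 1"
    using lp_Fatou[OF q0 lim wq(1) _ tendsto_const[of 1]] wq(3) by simp_all
  have vD: "v \<in> D1p p" by (rule D1pI[OF p0 q0 fev vq])
  define \<theta> where "\<theta> = lp_sum q UNIV v"
  have "c \<le> \<bar>v 0\<bar>"
  proof (rule LIMSEQ_le_const[OF tendsto_rabs[OF lim[of 0]]])
    show "\<exists>N. \<forall>n\<ge>N. c \<le> \<bar>w (\<sigma> n) 0\<bar>" using i by (auto simp: w_def intro!: less_imp_le)
  qed
  then have "0 < \<bar>v 0\<bar> powr q" using c(1) by simp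
  then have \<theta>: "0 < \<theta>" "\<theta> \<le> 1"
    using lp_member_le(1)[OF q0 vq UNIV_I, of 0] vq1 unfolding \<theta>_def by linarith+

  \<comment> \<open>Mass and energy split between \<open>v\<close> and the differences; comparing both parts with the infimum forces \<open>v\<close> to carry everything.\<close>
  let ?d = "\<lambda>n x. w (\<sigma> n) x - v x"
  have "(\<lambda>n. lp_sum q UNIV (w (\<sigma> n)) - lp_sum q UNIV (?d n)) \<longlonglongrightarrow> \<theta>"
    unfolding \<theta>_def by (rule Brezis_Lieb[OF q1 lim wq(1) _ vq, where M = 1]) (simp add: wq(2))
  from tendsto_diff[OF tendsto_const[of 1] this]
  have dq: "(\<lambda>n. lp_sum q UNIV (?d n)) \<longlonglongrightarrow> 1 - \<theta>" by (simp add: wq(3))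
  have "lp_norm p edges (grad (w n)) \<le> B" for n
    using B(1)[of n] B(2) p0 by (simp add: lp_norm_le_iff E_def[symmetric] Ew)
  from Brezis_Lieb[OF assms(2) glim gw this gv]
  have "(\<lambda>n. E (w (\<sigma> n)) - E (?d n)) \<longlonglongrightarrow> E v" by (simp add: E_def grad_diff)
  from tendsto_diff[OF Es this] have dE: "(\<lambda>n. E (?d n)) \<longlonglongrightarrow> ?S - E v" by simp
  have fed: "finite_energy p (?d n)" for n
    unfolding finite_energy_iff_in_lp grad_diff by (rule lp_diff(1)[OF assms(2) gw gv])
  have ind: "in_lp q UNIV (?d n)" for n by (rule lp_diff(1)[OF q1 wq(1) vq])
  have norm_sum: "lp_norm q UNIV f powr p = lp_sum q UNIV f powr (p / q)" for f :: "int ^ 'n \<Rightarrow> real"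
    by (simp add: lp_norm_def powr_powr)
  have v_ge: "?S * \<theta> powr (p / q) \<le> E v"
    using sobolev_const_le[OF p0 q0 fev vq] by (simp add: norm_sum \<theta>_def E_def)
  have "?S * lp_sum q UNIV (?d n) powr (p / q) \<le> E (?d n)" for n
    using sobolev_const_le[OF p0 q0 fed[of n] ind[of n]] by (simp add: norm_sum E_def)
  moreover have "(\<lambda>n. ?S * lp_sum q UNIV (?d n) powr (p / q)) \<longlonglongrightarrow> ?S * (1 - \<theta>) powr (p / q)"
    using p0 q0 by (intro tendsto_mult tendsto_const tendsto_powr' dq) auto
  ultimately have d_ge: "?S * (1 - \<theta>) powr (p / q) \<le> ?S - E v"
    by (intro LIMSEQ_le[OF _ dE]) auto
  have "?S * (\<theta> powr (p / q) + (1 - \<theta>) powr (p / q)) \<le> ?S * 1"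
    using v_ge d_ge by (simp add: distrib_left)
  then have "\<theta> powr (p / q) + (1 - \<theta>) powr (p / q) \<le> 1" using S by (simp only: mult_le_cancel_left_pos)
  then have "\<theta> = 1" using powr_strict_concave_split[of "p / q" \<theta>] p0 q0 pq \<theta> by simp
  then have Ev: "E v = ?S" using v_ge d_ge by simp
  then have "(\<lambda>n. E (?d n)) \<longlonglongrightarrow> 0" using dE by simp
  then have conv: "D1p_converges p (\<lambda>k. w (\<sigma> k)) v"
    unfolding D1p_converges_iff_lp_sum[of p "\<lambda>k. w (\<sigma> k)", OF p0 fed] E_def .

  show ?thesis
  proof (intro exI bexI conjI)
    show "D1p_converges p (\<lambda>k x. u (\<sigma> k) (x + i (\<sigma> k))) v"
      using conv unfolding w_def .
    show "lq_norm q v = 1" using \<open>\<theta> = 1\<close> by (simp add: lq_norm_eq_lp_norm lp_norm_def \<theta>_def)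
    show "D1p_norm p v powr p = ?S"
      using Ev by (simp add: D1p_norm_eq_lp_norm[OF fev] lp_norm_powr[OF p0] E_def)
  qed (fact \<sigma> vD)+
qed

end
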